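(* Let $k\ge 2$ and let $\varphi_k:(\mathbb{K}^{2k-2},0)\to(\mathbb{K}^{2k-1},0)$ be the minimal cross cap mapping of multiplicity $k$. For each $j$ with $1\le j\le k-1$, the vector field $\xi^2_j$ on $(\mathbb{K}^{2k-1},0)$ whose components are \[ \xi^2_j=(A^2_{1,j},\dots,A^2_{k-2,j},B^2_{1,j},\dots,B^2_{k-1,j},C^2_{1,j},C^2_{2,j})^T \] with \begin{align*} A_{i,j}^2&=-k(k+i-j+1)U_{k+i-j+1}W_1+k\sum_{r=1}^i(k+i-j-2r+1)U_rU_{k+i-j-r+1}\\ &\quad-j(i+1)U_{i+1}U_{k-j}, && 1\le i\le k-2,\\ B_{i,j}^2&=-k(k+i-j+1)V_{k+i-j+1}W_1+k\sum_{r=1}^i(k+i-j-r+1)U_rV_{k+i-j-r+1}\\ &\quad-k\sum_{r=1}^irU_{k+i-j-r+1}V_r-j(i+1)U_{k-j}V_{i+1}, && 1\le i\le k-1,\\ C_{1,j}^2&=k(k-j+1)U_{k-j+1}W_1+jU_1U_{k-j},\\ C_{2,j}^2&=k(k-j+1)V_{k-j+1}W_1+jV_1U_{k-j} \end{align*} is liftable over $\varphi_k$.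
   Context: $\mathbb{K}=\mathbb{R}$ or $\mathbb{C}$; maps, functions and vector fields are germs that are smooth (infinitely differentiable) or $\mathbb{K}$-analytic. The minimal cross cap mapping of multiplicity $k\ge2$ is $\varphi_k:(\mathbb{K}^{2k-2},0)\to(\mathbb{K}^{2k-1},0)$, \[ \varphi_k(u_1,\ldots,u_{k-2},v_1,\ldots,v_{k-1},y)=\Big(u_1,\ldots,u_{k-2},v_1,\ldots,v_{k-1},\,y^k+\sum_{i=1}^{k-2}u_iy^i,\ \sum_{i=1}^{k-1}v_iy^i\Big). \] The coordinates on the target are, in order, $U_1,\dots,U_{k-2},V_1,\dots,V_{k-1},W_1,W_2$; components of vector fields are listed in this order. Dummy variable convention: $U_{k-1}=V_k=0$, $U_k=1$, and $U_r=V_r=0$ for $r\le 0$ and for $r>k$. Empty sums are $0$. A vector field germ $\xi$ on $(\mathbb{K}^p,0)$ is liftable over $f:(\mathbb{K}^n,0)\to(\mathbb{K}^p,0)$ if there is a vector field germ $\eta$ on $(\mathbb{K}^n,0)$ with $df\circ\eta=\xi\circ f$, i.e. (writing vector fields as column vectors of functions and $J_f$ for the Jacobian matrix) $J_f\,\eta=\xi\circ f$. *)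

theory Defs
  imports "HOL-Analysis.Analysis"
begin

text \<open>
  The ground field is a type \<open>'a::real_normed_field\<close>, to be instantiated with \<^typ>\<open>real\<close> and
  \<^typ>\<open>complex\<close>. Germs at 0 are represented by total functions; every
  condition below depends only on the values in a neighbourhood of 0.
\<close>

subsection \<open>Smooth and analytic germs\<close>

text \<open>
  \<open>f\<close> is \<open>m\<close> times continuously differentiable on the open set \<open>S\<close>, in terms of partial
  derivatives over the ground field: for \<^typ>\<open>complex\<close> these are complex partial derivatives.
\<close>

primrec differentiable_times ::
  "nat \<Rightarrow> ('a::real_normed_field ^ 'n) set \<Rightarrow> ('a ^ 'n \<Rightarrow> 'a) \<Rightarrow> bool" where
  "differentiable_times 0 S f \<longleftrightarrow> continuous_on S f"
| "differentiable_times (Suc m) S f \<longleftrightarrow>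
     (\<exists>D :: 'n \<Rightarrow> 'a ^ 'n \<Rightarrow> 'a. \<forall>i.
        (\<forall>x\<in>S. ((\<lambda>h. f (x + axis i h)) has_field_derivative D i x) (at 0)) \<and>
        differentiable_times m S (D i))"

definition smooth_germ :: "('a::real_normed_field ^ 'n \<Rightarrow> 'a) \<Rightarrow> bool" where
  "smooth_germ f \<longleftrightarrow> (\<exists>S. open S \<and> 0 \<in> S \<and> (\<forall>m. differentiable_times m S f))"

text \<open>The sum ranges over all multi-indices \<open>\<alpha> :: 'n \<Rightarrow> nat\<close>.\<close>

definition analytic_germ :: "('a::real_normed_field ^ 'n \<Rightarrow> 'a) \<Rightarrow> bool" where
  "analytic_germ f \<longleftrightarrow>
     (\<exists>c :: ('n \<Rightarrow> nat) \<Rightarrow> 'a.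
        \<forall>\<^sub>F x in nhds 0. ((\<lambda>\<alpha>. c \<alpha> * (\<Prod>i\<in>UNIV. (x $ i) ^ \<alpha> i)) has_sum f x) UNIV)"

datatype regularity = Smooth | Analytic

fun function_germ :: "regularity \<Rightarrow> ('a::real_normed_field ^ 'n \<Rightarrow> 'a) \<Rightarrow> bool" where
  "function_germ Smooth f \<longleftrightarrow> smooth_germ f"
| "function_germ Analytic f \<longleftrightarrow> analytic_germ f"

definition map_germ :: "regularity \<Rightarrow> ('a::real_normed_field ^ 'n \<Rightarrow> 'a ^ 'p) \<Rightarrow> bool" where
  "map_germ \<rho> f \<longleftrightarrow> f 0 = 0 \<and> (\<forall>b. function_germ \<rho> (\<lambda>x. f x $ b))"

text \<open>A vector field germ need not vanish at 0.\<close>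

definition vector_field_germ :: "regularity \<Rightarrow> ('a::real_normed_field ^ 'n \<Rightarrow> 'a ^ 'n) \<Rightarrow> bool" where
  "vector_field_germ \<rho> \<xi> \<longleftrightarrow> (\<forall>b. function_germ \<rho> (\<lambda>x. \<xi> x $ b))"

text \<open>
  For a map germ \<open>f\<close> the derivative is linear over the ground field, so \<^const>\<open>jacobian\<close> is the
  Jacobian matrix over the ground field also for \<^typ>\<open>complex\<close>.
\<close>

definition liftable ::
  "regularity \<Rightarrow> ('a::real_normed_field ^ 'n \<Rightarrow> 'a ^ 'p) \<Rightarrow> ('a ^ 'p \<Rightarrow> 'a ^ 'p) \<Rightarrow> bool" where
  "liftable \<rho> f \<xi> \<longleftrightarrow>
     map_germ \<rho> f \<and> vector_field_germ \<rho> \<xi> \<and>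
     (\<exists>\<eta>. vector_field_germ \<rho> \<eta> \<and> (\<forall>\<^sub>F x in nhds 0. jacobian f (at x) *v \<eta> x = \<xi> (f x)))"


subsection \<open>Numbered coordinates\<close>

text \<open>
  The dimensions are cardinalities of index types. A bijection \<open>e\<close> from
  \<open>{1..CARD('n)}\<close> onto the index type numbers the coordinates: the \<open>m\<close>-th coordinate of \<open>x\<close> is
  \<open>x $ e m\<close>, and \<open>vec_of_coords e c\<close> is the vector \<open>(c 1, \<dots>, c CARD('n))\<close>.
\<close>

definition vec_of_coords :: "(nat \<Rightarrow> 'n) \<Rightarrow> (nat \<Rightarrow> 'a) \<Rightarrow> 'a ^ 'n" where
  "vec_of_coords e c = (\<chi> b. c (inv_into {1..CARD('n)} e b))"


subsection \<open>The minimal cross cap mapping\<close>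

text \<open>
  Source coordinates \<open>u\<^sub>1, \<dots>, u\<^bsub>k-2\<^esub>, v\<^sub>1, \<dots>, v\<^bsub>k-1\<^esub>, y\<close> are numbered by \<open>s\<close>,
  target coordinates \<open>U\<^sub>1, \<dots>, U\<^bsub>k-2\<^esub>, V\<^sub>1, \<dots>, V\<^bsub>k-1\<^esub>, W\<^sub>1, W\<^sub>2\<close> by \<open>t\<close>.
\<close>

definition cross_cap ::
  "nat \<Rightarrow> (nat \<Rightarrow> 'n) \<Rightarrow> (nat \<Rightarrow> 'p) \<Rightarrow> 'a::real_normed_field ^ 'n \<Rightarrow> 'a ^ 'p" where
  "cross_cap k s t x =
     (let u = (\<lambda>i. x $ s i); v = (\<lambda>i. x $ s (k - 2 + i)); y = x $ s (2 * k - 2) in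
      vec_of_coords t (\<lambda>m.
        if m \<le> k - 2 then u m
        else if m \<le> 2 * k - 3 then v (m - (k - 2))
        else if m = 2 * k - 2 then y ^ k + (\<Sum>i=1..k-2. u i * y ^ i)
        else (\<Sum>i=1..k-1. v i * y ^ i)))"


subsection \<open>The vector fields\<close>

text \<open>
  Target coordinates with the dummy variable convention. Indices are integers, as they may be
  negative.
\<close>

definition U_coord :: "nat \<Rightarrow> (nat \<Rightarrow> 'p) \<Rightarrow> 'a::real_normed_field ^ 'p \<Rightarrow> int \<Rightarrow> 'a" where
  "U_coord k t X r =
     (if 1 \<le> r \<and> r \<le> int k - 2 then X $ t (nat r) else if r = int k then 1 else 0)"

definition V_coord :: "nat \<Rightarrow> (nat \<Rightarrow> 'p) \<Rightarrow> 'a::real_normed_field ^ 'p \<Rightarrow> int \<Rightarrow> 'a" where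
  "V_coord k t X r =
     (if 1 \<le> r \<and> r \<le> int k - 1 then X $ t (k - 2 + nat r) else 0)"

definition A2 :: "int \<Rightarrow> (int \<Rightarrow> 'a) \<Rightarrow> 'a \<Rightarrow> int \<Rightarrow> int \<Rightarrow> 'a::real_normed_field" where
  "A2 k U W\<^sub>1 i j =
     - of_int (k * (k+i-j+1)) * U (k+i-j+1) * W\<^sub>1
     + of_int k * (\<Sum>r=1..i. of_int (k+i-j-2*r+1) * U r * U (k+i-j-r+1))
     - of_int (j * (i+1)) * U (i+1) * U (k-j)"

definition B2 ::
  "int \<Rightarrow> (int \<Rightarrow> 'a) \<Rightarrow> (int \<Rightarrow> 'a) \<Rightarrow> 'a \<Rightarrow> int \<Rightarrow> int \<Rightarrow> 'a::real_normed_field" where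
  "B2 k U V W\<^sub>1 i j =
     - of_int (k * (k+i-j+1)) * V (k+i-j+1) * W\<^sub>1
     + of_int k * (\<Sum>r=1..i. of_int (k+i-j-r+1) * U r * V (k+i-j-r+1))
     - of_int k * (\<Sum>r=1..i. of_int r * U (k+i-j-r+1) * V r)
     - of_int (j * (i+1)) * U (k-j) * V (i+1)"

definition C2_1 :: "int \<Rightarrow> (int \<Rightarrow> 'a) \<Rightarrow> 'a \<Rightarrow> int \<Rightarrow> 'a::real_normed_field" where
  "C2_1 k U W\<^sub>1 j = of_int (k * (k-j+1)) * U (k-j+1) * W\<^sub>1 + of_int j * U 1 * U (k-j)"

definition C2_2 ::
  "int \<Rightarrow> (int \<Rightarrow> 'a) \<Rightarrow> (int \<Rightarrow> 'a) \<Rightarrow> 'a \<Rightarrow> int \<Rightarrow> 'a::real_normed_field" where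
  "C2_2 k U V W\<^sub>1 j = of_int (k * (k-j+1)) * V (k-j+1) * W\<^sub>1 + of_int j * V 1 * U (k-j)"

definition xi2 ::
  "nat \<Rightarrow> (nat \<Rightarrow> 'p) \<Rightarrow> nat \<Rightarrow> 'a::real_normed_field ^ 'p \<Rightarrow> 'a ^ 'p" where
  "xi2 k t j X =
     (let U = U_coord k t X; V = V_coord k t X; W\<^sub>1 = X $ t (2 * k - 2) in
      vec_of_coords t (\<lambda>m.
        if m \<le> k - 2 then A2 (int k) U W\<^sub>1 (int m) (int j)
        else if m \<le> 2 * k - 3 then B2 (int k) U V W\<^sub>1 (int (m - (k - 2))) (int j)
        else if m = 2 * k - 2 then C2_1 (int k) U W\<^sub>1 (int j)
        else C2_2 (int k) U V W\<^sub>1 (int j)))"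

end

theory Submission
  imports Defs
begin

text \<open>
  Let \<open>P = \<Sum>U\<^sub>r y\<^sup>r\<close> and \<open>Q = \<Sum>V\<^sub>r y\<^sup>r\<close> be the last two components of the cross cap map, dummy
  coordinates included. The first \<open>2k - 3\<close> components of a lift \<open>\<eta>\<close> are forced to be those of
  \<open>\<xi> \<circ> \<phi>\<close>, so the only unknown is the \<open>y\<close>-component \<open>E\<close>, subject to \<open>\<Sum>A\<^sub>i y\<^sup>i + P' E = C\<^sub>1\<close> and
  \<open>\<Sum>B\<^sub>i y\<^sup>i + Q' E = C\<^sub>2\<close>. With \<open>d = k - j + 1\<close>, collecting the double sums as products of
  polynomials in \<open>y\<close> shows that \<open>E = k \<Sum>\<^bsub>d\<le>s\<le>k\<^esub> U\<^sub>s y\<^bsup>s-d+1\<^esup> + j U\<^bsub>k-j\<^esub>\<close> solves both equations.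
  They are instances of a single identity, since \<open>A\<^sub>i\<close> and \<open>C\<^sub>1\<close> arise from \<open>B\<^sub>i\<close> and \<open>C\<^sub>2\<close> by
  putting \<open>V = U\<close>. All components of \<open>\<eta>\<close> are polynomials, hence smooth and analytic.
\<close>

subsection \<open>The generating function of the coefficients\<close>

text \<open>With \<open>s = d+i-r\<close> the condition \<open>r \<le> i\<close> becomes
  \<open>d \<le> s\<close>, so the antidiagonals fill a rectangle. The bound \<open>2*k\<close> is
  large enough, since \<open>r+s-d < 2*k\<close> whenever \<open>r\<close> and \<open>s\<close> are
  at most \<open>k\<close>.\<close>

lemma double_sum_reindex:
  fixes f :: "int \<Rightarrow> int \<Rightarrow> 'a::comm_monoid_add"
  assumes "1 \<le> d" and "\<And>r s. k < r \<or> k < s \<Longrightarrow> f r s = 0"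
  shows "(\<Sum>i=1..2*k. \<Sum>r=1..i. f r (d+i-r)) = (\<Sum>r=1..k. \<Sum>s=d..k. f r s)"
proof -
  have "(\<Sum>i=1..2*k. \<Sum>r=1..i. f r (d+i-r)) = (\<Sum>(i,r)\<in>(SIGMA i:{1..2*k}. {1..i}). f r (d+i-r))"
    by (rule sum.Sigma) auto
  \<comment> \<open>\<open>S'\<close> collects the index pairs that land outside the rectangle;
    \<open>f\<close> vanishes there.\<close>
  also have "\<dots> = (\<Sum>(r,s)\<in>{1..k}\<times>{d..k}. f r s)"
    by (rule sum.reindex_bij_witness_not_neutral[where
          S' = "{(i,r)\<in>(SIGMA i:{1..2*k}. {1..i}). k < r \<or> k < d+i-r}" and T' = "{}" and
          i = "\<lambda>(r,s). (r+s-d, r)" and j = "\<lambda>(i,r). (r, d+i-r)"])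
       (use assms in \<open>auto intro: finite_subset[of _ "(SIGMA i:{1..2*k}. {1..i})"]\<close>)
  also have "\<dots> = (\<Sum>r=1..k. \<Sum>s=d..k. f r s)"
    by (rule sum.Sigma[symmetric]) auto
  finally show ?thesis .
qed

text \<open>The shifted sum starts at \<open>c+1\<close> and so misses the term \<open>g c\<close>.
  These missing terms will make up \<open>C2_2\<close>.\<close>

lemma sum_shift_index:
  fixes g :: "int \<Rightarrow> 'a::ab_group_add"
  assumes "0 \<le> c" "c \<le> k" and "\<And>s. k < s \<Longrightarrow> g s = 0"
  shows "(\<Sum>i=1..2*k. g (c+i)) = (\<Sum>s=c..k. g s) - g c"
proof -
  have "(\<Sum>i=1..2*k. g (c+i)) = (\<Sum>s=c+1..c+2*k. g s)"
    by (rule sum.reindex_bij_witness[where i = "\<lambda>s. s - c" and j = "\<lambda>i. c + i"]) auto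
  also have "\<dots> = (\<Sum>s=c+1..k. g s)"
    by (rule sum.mono_neutral_right) (use assms in auto)
  also have "{c..k} = insert c {c+1..k}"
    using assms by auto
  then have "(\<Sum>s=c+1..k. g s) = (\<Sum>s=c..k. g s) - g c"
    by simp
  finally show ?thesis .
qed

context
  fixes k j d :: int and U V :: "int \<Rightarrow> 'a::real_normed_field"
  assumes d: "d = k - j + 1" and j: "1 \<le> j" "j \<le> k - 1"
    and U0: "\<And>r. r < 1 \<or> k < r \<Longrightarrow> U r = 0"
    and V0: "\<And>r. r < 1 \<or> k < r \<Longrightarrow> V r = 0"
begin

text \<open>Separates the factors depending on \<open>i\<close> from the constant ones: each of the
  four terms becomes a constant times a coefficient of a polynomial or of a product of two
  polynomials.\<close>

lemma B2_alt:
  "B2 k U V W i j =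
     - of_int k * W * (of_int (d+i) * V (d+i))
     + of_int k * (\<Sum>r=1..i. of_int (d+i-r) * U r * V (d+i-r))
     - of_int k * (\<Sum>r=1..i. of_int r * U (d+i-r) * V r)
     - of_int j * U (d-1) * (of_int (i+1) * V (i+1))"
  unfolding B2_def d by (simp add: algebra_simps)

text \<open>After the reflection both sums in \<open>B2\<close> have the same summand and differ
  only in their ranges.\<close>

lemma reflected_sum:
  "(\<Sum>r=1..i. of_int (d+i-r) * U r * V (d+i-r)) = (\<Sum>r=d..d+i-1. of_int r * U (d+i-r) * V r)"
  by (rule sum.reindex_bij_witness[where i = "\<lambda>r. d+i-r" and j = "\<lambda>r. d+i-r"]) auto

text \<open>Outside the range \<open>1 \<le> i \<le> k - 1\<close> the two sums in \<open>B2\<close> cancel after the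
  reflection \<open>r \<mapsto> d + i - r\<close>. For \<open>V = U\<close> and \<open>i = k - 1\<close> a boundary term survives, which the
  last term of \<open>A2\<close> compensates; this is what makes \<open>U\<^bsub>k-1\<^esub> = 0\<close> consistent.\<close>

lemma B2_eq_0:
  assumes "k \<le> i"
  shows "B2 k U V W i j = 0"
proof -
  \<comment> \<open>Both ranges shrink to \<open>{d..i}\<close>: for \<open>r > i\<close> the factor
    \<open>V r\<close> vanishes, and for \<open>r < d\<close> the index \<open>d+i-r\<close> exceeds
    \<open>k\<close>, so the factor \<open>U (d+i-r)\<close> vanishes.\<close>
  have "(\<Sum>r=d..d+i-1. of_int r * U (d+i-r) * V r) = (\<Sum>r=d..i. of_int r * U (d+i-r) * V r)"
    by (rule sum.mono_neutral_right) (use assms d j in \<open>auto simp: V0\<close>)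
  moreover have "(\<Sum>r=1..i. of_int r * U (d+i-r) * V r) = (\<Sum>r=d..i. of_int r * U (d+i-r) * V r)"
    by (rule sum.mono_neutral_right) (use assms d j in \<open>auto simp: U0\<close>)
  ultimately show ?thesis
    unfolding B2_alt reflected_sum using assms d j by (simp add: V0)
qed

lemma B2_diagonal_eq_0:
  assumes "U k = 1"
  shows "B2 k U U W (k-1) j = 0"
proof -
  let ?f = "\<lambda>r. of_int r * U (d+(k-1)-r) * U r"
  have "(\<Sum>r=d..d+(k-1)-1. ?f r) = (\<Sum>r=d..k. ?f r)"
    by (rule sum.mono_neutral_right) (use d j in \<open>auto simp: U0\<close>)
  also have "{d..k} = insert k {d..k-1}"
    using d j by auto
  also have "(\<Sum>r\<in>insert k {d..k-1}. ?f r) = (\<Sum>r=d..k-1. ?f r) + of_int k * U (d-1)"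
    by (simp add: assms)
  finally have 1: "(\<Sum>r=d..d+(k-1)-1. ?f r) = (\<Sum>r=d..k-1. ?f r) + of_int k * U (d-1)" .
  \<comment> \<open>Below \<open>d-1\<close> the index \<open>d+(k-1)-r\<close> exceeds
    \<open>k\<close>; at \<open>r = d-1\<close> it equals \<open>k\<close>, which gives the second
    boundary term.\<close>
  have "(\<Sum>r=1..k-1. ?f r) = (\<Sum>r=d-1..k-1. ?f r)"
    by (rule sum.mono_neutral_right) (use d j in \<open>auto simp: U0\<close>)
  also have "{d-1..k-1} = insert (d-1) {d..k-1}"
    using d j by auto
  also have "(\<Sum>r\<in>insert (d-1) {d..k-1}. ?f r) = (\<Sum>r=d..k-1. ?f r) + of_int (d-1) * U (d-1)"
    by (simp add: assms)
  finally have 2: "(\<Sum>r=1..k-1. ?f r) = (\<Sum>r=d..k-1. ?f r) + of_int (d-1) * U (d-1)" .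
  have 3: "(\<Sum>r=1..k-1. of_int (d+(k-1)-r) * U r * U (d+(k-1)-r)) = (\<Sum>r=d..d+(k-1)-1. ?f r)"
    by (rule sum.reindex_bij_witness[where i = "\<lambda>r. d+(k-1)-r" and j = "\<lambda>r. d+(k-1)-r"]) auto
  have "B2 k U U W (k-1) j =
     - of_int k * W * (of_int (d+(k-1)) * U (d+(k-1)))
     + of_int k * (\<Sum>r=1..k-1. of_int (d+(k-1)-r) * U r * U (d+(k-1)-r))
     - of_int k * (\<Sum>r=1..k-1. ?f r)
     - of_int j * U (d-1) * (of_int (k-1+1) * U (k-1+1))"
    unfolding B2_def d by (simp add: algebra_simps)
  \<comment> \<open>The boundary terms differ by \<open>(k-(d-1)) * U (d-1) = j * U (d-1)\<close>;
    multiplied by \<open>k\<close> this cancels the last term, where \<open>U k = 1\<close>.\<close>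
  then show ?thesis
    unfolding 1 2 3 using d j by (simp add: U0 assms algebra_simps)
qed

text \<open>The two multiples of \<open>P * R\<close> cancel, and what remains is
  \<open>- Q' * E\<close> plus the terms with \<open>V d\<close> and \<open>V 1\<close> that the
  shifted sums miss; the latter form \<open>C2_2\<close>. As \<open>V k\<close> may be nonzero, the
  case \<open>V = U\<close> is included.\<close>

lemma B2_generating_function:
  fixes y :: 'a
  defines "P \<equiv> \<Sum>r=1..k. U r * y ^ nat r"
    and "E \<equiv> of_int k * (\<Sum>s=d..k. U s * y ^ nat (s-d+1)) + of_int j * U (k-j)"
  shows "(\<Sum>i=1..k-1. B2 k U V P i j * y ^ nat i) +
           (\<Sum>r=1..k. of_int r * V r * y ^ nat (r-1)) * E = C2_2 k U V P j"
proof -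
  \<comment> \<open>\<open>G\<close> and \<open>R\<close> are the parts of \<open>P\<close> and of
    \<open>y * Q'\<close> of degree at least \<open>d\<close>, divided by
    \<open>y^d\<close>.\<close>
  define G where "G = (\<Sum>s=d..k. U s * y ^ nat (s-d))"
  define Q' where "Q' = (\<Sum>r=1..k. of_int r * V r * y ^ nat (r-1))"
  define R where "R = (\<Sum>s=d..k. of_int s * V s * y ^ nat (s-d))"
  have d': "1 \<le> d" "d \<le> k" using d j by auto
  have E: "E = of_int k * (y * G) + of_int j * U (d-1)"
  proof -
    have "(\<Sum>s=d..k. U s * y ^ nat (s-d+1)) = y * G"
      unfolding G_def sum_distrib_left
      by (rule sum.cong) (auto simp: nat_add_distrib)
    then show ?thesis by (simp add: E_def d)
  qed
  have S1: "(\<Sum>i=1..2*k. of_int (d+i) * V (d+i) * y ^ nat i) = R - of_int d * V d"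
    using sum_shift_index[of d k "\<lambda>s. of_int s * V s * y ^ nat (s-d)"] d'
    by (simp add: R_def V0)
  have S2: "(\<Sum>i=1..2*k. (\<Sum>r=1..i. of_int (d+i-r) * U r * V (d+i-r)) * y ^ nat i) = P * R"
  proof -
    have "(\<Sum>i=1..2*k. (\<Sum>r=1..i. of_int (d+i-r) * U r * V (d+i-r)) * y ^ nat i) =
        (\<Sum>r=1..k. \<Sum>s=d..k. of_int s * U r * V s * y ^ nat (r+s-d))"
      unfolding sum_distrib_right
      by (subst double_sum_reindex[symmetric]) (use d' in \<open>auto simp: U0 V0\<close>)
    also have "\<dots> = P * R"
      unfolding P_def R_def sum_product
    proof (intro sum.cong refl)
      fix r s assume "r \<in> {1..k}" "s \<in> {d..k}"
      then have "nat (r+s-d) = nat r + nat (s-d)" by auto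
      then show "of_int s * U r * V s * y ^ nat (r+s-d) =
          U r * y ^ nat r * (of_int s * V s * y ^ nat (s-d))"
        by (simp add: power_add)
    qed
    finally show ?thesis .
  qed
  have S3: "(\<Sum>i=1..2*k. (\<Sum>r=1..i. of_int r * U (d+i-r) * V r) * y ^ nat i) = y * Q' * G"
  proof -
    have "(\<Sum>i=1..2*k. (\<Sum>r=1..i. of_int r * U (d+i-r) * V r) * y ^ nat i) =
        (\<Sum>r=1..k. \<Sum>s=d..k. of_int r * U s * V r * y ^ nat (r+s-d))"
      unfolding sum_distrib_right
      by (subst double_sum_reindex[symmetric]) (use d' in \<open>auto simp: U0 V0\<close>)
    \<comment> \<open>The extra factor \<open>y\<close> makes up for the exponent \<open>r-1\<close>
      in \<open>Q'\<close>.\<close>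
    also have "\<dots> = y * (Q' * G)"
      unfolding Q'_def G_def sum_product unfolding sum_distrib_left
    proof (intro sum.cong refl)
      fix r s assume "r \<in> {1..k}" "s \<in> {d..k}"
      then have "nat (r+s-d) = Suc (nat (r-1) + nat (s-d))" by auto
      then show "of_int r * U s * V r * y ^ nat (r+s-d) =
          y * (of_int r * V r * y ^ nat (r-1) * (U s * y ^ nat (s-d)))"
        by (simp add: power_add)
    qed
    finally show ?thesis by (simp add: mult.assoc)
  qed
  have S4: "(\<Sum>i=1..2*k. of_int (i+1) * V (i+1) * y ^ nat i) = Q' - V 1"
    using sum_shift_index[of 1 k "\<lambda>s. of_int s * V s * y ^ nat (s-1)"] d'
    by (simp add: Q'_def V0 add.commute)
  have linear_combination: "(\<Sum>i\<in>I. a * f1 i + b * f2 i - b * f3 i - c * f4 i) =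
      a * sum f1 I + b * sum f2 I - b * sum f3 I - c * sum f4 I"
    for a b c :: 'a and f1 f2 f3 f4 and I :: "int set"
    by (simp add: sum.distrib sum_subtractf sum_distrib_left)
  \<comment> \<open>Coefficients from \<open>k\<close> on are zero; the longer range lets the
    antidiagonal sums become complete products.\<close>
  have "(\<Sum>i=1..k-1. B2 k U V P i j * y ^ nat i) = (\<Sum>i=1..2*k. B2 k U V P i j * y ^ nat i)"
    by (rule sum.mono_neutral_left) (use d' in \<open>auto simp: B2_eq_0\<close>)
  also have "\<dots> =
      - of_int k * P * (\<Sum>i=1..2*k. of_int (d+i) * V (d+i) * y ^ nat i)
      + of_int k * (\<Sum>i=1..2*k. (\<Sum>r=1..i. of_int (d+i-r) * U r * V (d+i-r)) * y ^ nat i)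
      - of_int k * (\<Sum>i=1..2*k. (\<Sum>r=1..i. of_int r * U (d+i-r) * V r) * y ^ nat i)
      - of_int j * U (d-1) * (\<Sum>i=1..2*k. of_int (i+1) * V (i+1) * y ^ nat i)"
    unfolding linear_combination[symmetric] B2_alt
    by (intro sum.cong refl) (simp only: ring_distribs mult.assoc)
  also have "\<dots> = of_int (k*d) * V d * P - Q' * E + of_int j * V 1 * U (d-1)"
    unfolding S1 S2 S3 S4 E by (simp add: algebra_simps)
  finally show ?thesis
    unfolding Q'_def[symmetric] C2_2_def d by simp
qed

end

text \<open>The coefficient splits as \<open>k+i-j-2*r+1 = (k+i-j-r+1) - r\<close>, which separates
  the single sum of \<open>A2\<close> into the two sums of \<open>B2\<close>.\<close>

lemma A2_eq_B2: "A2 k U W i j = B2 k U U W i j"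
proof -
  have "(\<Sum>r=1..i. of_int (k+i-j-2*r+1) * U r * U (k+i-j-r+1)) =
      (\<Sum>r=1..i. of_int (k+i-j-r+1) * U r * U (k+i-j-r+1)) -
      (\<Sum>r=1..i. of_int r * U (k+i-j-r+1) * U r)"
    unfolding sum_subtractf[symmetric] by (rule sum.cong) (auto simp: algebra_simps)
  then show ?thesis
    unfolding A2_def B2_def by (simp add: right_diff_distrib mult.assoc mult.commute[of "U (k-j)"])
qed

lemma C2_1_eq_C2_2: "C2_1 k U W j = C2_2 k U U W j"
  by (simp add: C2_1_def C2_2_def)

subsection \<open>Polynomial functions and Jacobians\<close>

text \<open>The same product as in the power series of \<open>analytic_germ\<close>.\<close>

definition monomial :: "('n \<Rightarrow> nat) \<Rightarrow> 'a::comm_semiring_1 ^ 'n \<Rightarrow> 'a" where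
  "monomial \<alpha> x = (\<Prod>i\<in>UNIV. (x $ i) ^ \<alpha> i)"

text \<open>Building polynomials one monomial at a time gives an induction suited to both partial
  derivatives and power series coefficients.\<close>

inductive polynomial_map :: "('a::real_normed_field ^ 'n \<Rightarrow> 'a) \<Rightarrow> bool" where
  polynomial_map_0: "polynomial_map (\<lambda>x. 0)"
| polynomial_map_add_monomial:
    "polynomial_map f \<Longrightarrow> polynomial_map (\<lambda>x. f x + c * monomial \<alpha> x)"

lemma polynomial_map_monomial: "polynomial_map (\<lambda>x. c * monomial \<alpha> x)"
  using polynomial_map_add_monomial[OF polynomial_map_0, of c \<alpha>] by simp

lemma polynomial_map_add:
  assumes "polynomial_map f" and "polynomial_map g"
  shows "polynomial_map (\<lambda>x. f x + g x)"
  using assms(2)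
proof induction
  case (polynomial_map_add_monomial g c \<alpha>)
  then show ?case
    using polynomial_map.intros(2)[of "\<lambda>x. f x + g x" c \<alpha>] by (simp add: add.assoc)
qed (simp add: assms)

lemma monomial_mult: "monomial \<alpha> x * monomial \<beta> x = monomial (\<lambda>i. \<alpha> i + \<beta> i) x"
  by (simp add: monomial_def power_add prod.distrib)

lemma polynomial_map_mult:
  assumes "polynomial_map f" and "polynomial_map g"
  shows "polynomial_map (\<lambda>x. f x * g x)"
  using assms(1)
proof induction
  case (polynomial_map_add_monomial f c \<alpha>)
  \<comment> \<open>An inner induction on \<open>g\<close> treats the product with a single
    monomial.\<close>
  have "polynomial_map (\<lambda>x. c * monomial \<alpha> x * g x)"
    using assms(2)
  proof induction
    case (polynomial_map_add_monomial g d \<beta>)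
    have "c * monomial \<alpha> x * (g x + d * monomial \<beta> x) =
        c * monomial \<alpha> x * g x + c * d * monomial (\<lambda>i. \<alpha> i + \<beta> i) x" for x
      by (simp add: distrib_left monomial_mult[symmetric] mult_ac)
    with polynomial_map_add_monomial show ?case
      by (simp add: polynomial_map.intros(2))
  qed (simp add: polynomial_map_0)
  with polynomial_map_add_monomial show ?case
    by (simp add: distrib_right polynomial_map_add)
qed (simp add: polynomial_map_0)

lemma polynomial_map_const: "polynomial_map (\<lambda>x. c)"
  using polynomial_map_monomial[of c "\<lambda>_. 0"] by (simp add: monomial_def)

lemma polynomial_map_nth: "polynomial_map (\<lambda>x :: 'a::real_normed_field ^ 'n. x $ i)"
proof -
  have "monomial (\<lambda>j. if j = i then 1 else 0) = (\<lambda>x :: 'a ^ 'n. x $ i)"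
  proof
    fix x :: "'a ^ 'n"
    have "monomial (\<lambda>j. if j = i then 1 else 0) x = (\<Prod>j\<in>UNIV. if j = i then x $ j else 1)"
      unfolding monomial_def by (rule prod.cong) auto
    then show "monomial (\<lambda>j. if j = i then 1 else 0) x = x $ i" by simp
  qed
  with polynomial_map_monomial[of "1 :: 'a" "\<lambda>j :: 'n. if j = i then 1 else 0"] show ?thesis
    by (simp only: mult_1)
qed

lemma polynomial_map_minus: "polynomial_map f \<Longrightarrow> polynomial_map (\<lambda>x. - f x)"
  using polynomial_map_mult[OF polynomial_map_const[of "- 1"], of f] by simp

lemma polynomial_map_diff:
  "polynomial_map f \<Longrightarrow> polynomial_map g \<Longrightarrow> polynomial_map (\<lambda>x. f x - g x)"
  using polynomial_map_add[OF _ polynomial_map_minus, of f g] by simp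

lemma polynomial_map_sum:
  "(\<And>i. i \<in> I \<Longrightarrow> polynomial_map (f i)) \<Longrightarrow> polynomial_map (\<lambda>x. \<Sum>i\<in>I. f i x)"
  by (induction I rule: infinite_finite_induct)
     (auto intro: polynomial_map_const polynomial_map_add)

lemma polynomial_map_prod:
  "(\<And>i. i \<in> I \<Longrightarrow> polynomial_map (f i)) \<Longrightarrow> polynomial_map (\<lambda>x. \<Prod>i\<in>I. f i x)"
  by (induction I rule: infinite_finite_induct)
     (auto intro: polynomial_map_const polynomial_map_mult)

lemma polynomial_map_power: "polynomial_map f \<Longrightarrow> polynomial_map (\<lambda>x. f x ^ m)"
  by (induction m) (auto intro: polynomial_map_const polynomial_map_mult)

lemma polynomial_map_If:
  "(b \<Longrightarrow> polynomial_map f) \<Longrightarrow> (\<not> b \<Longrightarrow> polynomial_map g) \<Longrightarrow>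
    polynomial_map (\<lambda>x. if b then f x else g x)"
  by (cases b) simp_all

lemmas polynomial_map_intros =
  polynomial_map_const polynomial_map_nth polynomial_map_add polynomial_map_mult
  polynomial_map_minus polynomial_map_diff polynomial_map_sum polynomial_map_power

lemma polynomial_map_compose:
  assumes "polynomial_map g" and "\<And>b. polynomial_map (\<lambda>x. f x $ b)"
  shows "polynomial_map (\<lambda>x. g (f x))"
  using assms(1)
  by induction
     (auto simp: monomial_def intro!: polynomial_map_intros polynomial_map_prod assms(2))

section \<open>Smoothness and analyticity of polynomial functions\<close>

lemma polynomial_map_continuous_on: "polynomial_map f \<Longrightarrow> continuous_on S f"
  by (induction rule: polynomial_map.induct) (auto simp: monomial_def intro!: continuous_intros)

text \<open>Only the factor at \<open>i\<close> varies, so this is the derivative of a power in one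
  variable. If \<open>\<alpha> i = 0\<close>, the truncated exponent is harmless because the
  coefficient is zero.\<close>

lemma has_field_derivative_monomial_axis:
  fixes x :: "'a::real_normed_field ^ 'n"
  shows "((\<lambda>h. monomial \<alpha> (x + axis i h)) has_field_derivative
           of_nat (\<alpha> i) * monomial (\<alpha>(i := \<alpha> i - 1)) x) (at 0)"
proof -
  have *: "monomial \<beta> (x + axis i h) = (x $ i + h) ^ \<beta> i * (\<Prod>l\<in>UNIV-{i}. (x $ l) ^ \<beta> l)" for \<beta> h
    unfolding monomial_def by (subst prod.remove[of _ i]) (auto simp: axis_def intro!: prod.cong)
  have "monomial (\<alpha>(i := \<alpha> i - 1)) x = (x $ i) ^ (\<alpha> i - 1) * (\<Prod>l\<in>UNIV-{i}. (x $ l) ^ \<alpha> l)"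
    unfolding monomial_def by (subst prod.remove[of _ i]) (auto intro!: prod.cong)
  then show ?thesis
    unfolding * by (auto intro!: derivative_eq_intros)
qed

lemma polynomial_map_partial_derivative:
  assumes "polynomial_map f"
  obtains D where "polynomial_map D"
    and "\<And>x. ((\<lambda>h. f (x + axis i h)) has_field_derivative D x) (at 0)"
proof -
  have "\<exists>D. polynomial_map D \<and> (\<forall>x. ((\<lambda>h. f (x + axis i h)) has_field_derivative D x) (at 0))"
    using assms
  proof induction
    case polynomial_map_0
    show ?case by (intro exI[of _ "\<lambda>_. 0"]) (auto intro: polynomial_map_const)
  next
    case (polynomial_map_add_monomial f c \<alpha>)
    then obtain D where D: "polynomial_map D"
      "\<And>x. ((\<lambda>h. f (x + axis i h)) has_field_derivative D x) (at 0)" by blast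
    let ?D = "\<lambda>x. D x + (c * of_nat (\<alpha> i)) * monomial (\<alpha>(i := \<alpha> i - 1)) x"
    have "polynomial_map ?D"
      by (intro polynomial_map.intros(2) D)
    moreover have "((\<lambda>h. f (x + axis i h) + c * monomial \<alpha> (x + axis i h))
        has_field_derivative ?D x) (at 0)" for x
      unfolding mult.assoc by (intro DERIV_add D DERIV_cmult has_field_derivative_monomial_axis)
    ultimately show ?case by blast
  qed
  then show ?thesis using that by blast
qed

lemma polynomial_map_differentiable_times:
  "polynomial_map f \<Longrightarrow> differentiable_times m S f"
proof (induction m arbitrary: f)
  case 0
  then show ?case by (simp add: polynomial_map_continuous_on)
next
  case (Suc m)
  have "\<exists>D. polynomial_map D \<and> (\<forall>x. ((\<lambda>h. f (x + axis i h)) has_field_derivative D x) (at 0))" for i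
    using polynomial_map_partial_derivative[OF Suc.prems] by metis
  then obtain D where "\<And>i. polynomial_map (D i)"
    "\<And>i x. ((\<lambda>h. f (x + axis i h)) has_field_derivative D i x) (at 0)" by metis
  with Suc.IH show ?case
    unfolding differentiable_times.simps by blast
qed

text \<open>A polynomial is its own power series; each added monomial changes one
  coefficient.\<close>

lemma polynomial_map_has_sum:
  assumes "polynomial_map f"
  shows "\<exists>c. \<forall>x. ((\<lambda>\<alpha>. c \<alpha> * monomial \<alpha> x) has_sum f x) UNIV"
  using assms
proof induction
  case polynomial_map_0
  show ?case by (rule exI[of _ "\<lambda>_. 0"]) simp
next
  case (polynomial_map_add_monomial f a \<alpha>)
  then obtain c where c: "\<And>x. ((\<lambda>\<alpha>. c \<alpha> * monomial \<alpha> x) has_sum f x) UNIV" by blast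
  have "((\<lambda>\<beta>. (if \<beta> = \<alpha> then a else 0) * monomial \<beta> x) has_sum a * monomial \<alpha> x) UNIV" for x
    by (rule has_sum_finite_neutralI[of "{\<alpha>}"]) auto
  from has_sum_add[OF c this] show ?case
    by (intro exI[of _ "\<lambda>\<beta>. c \<beta> + (if \<beta> = \<alpha> then a else 0)"]) (simp add: distrib_right)
qed

lemma polynomial_map_function_germ:
  assumes "polynomial_map f"
  shows "function_germ \<rho> f"
proof (cases \<rho>)
  case Smooth
  then show ?thesis
    using polynomial_map_differentiable_times[OF assms, of _ UNIV]
    by (auto simp: smooth_germ_def intro!: exI[of _ UNIV])
next
  case Analytic
  then show ?thesis
    using polynomial_map_has_sum[OF assms]
    by (auto simp: analytic_germ_def monomial_def intro: always_eventually)
qed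

section \<open>Componentwise derivatives and the Jacobian over the ground field\<close>

lemma has_derivative_vec:
  fixes f :: "'b::real_normed_vector \<Rightarrow> 'a::real_normed_vector ^ 'n"
  assumes "\<And>i. ((\<lambda>x. f x $ i) has_derivative (\<lambda>h. f' h $ i)) F"
  shows "(f has_derivative f') F"
proof -
  have lin: "bounded_linear (\<lambda>h. f' h $ i)" for i
    using assms by (rule has_derivative_bounded_linear)
  obtain K where K: "\<And>i h. norm (f' h $ i) \<le> norm h * K i"
    using bounded_linear.bounded[OF lin] by metis
  have "bounded_linear f'"
  proof
    show "f' (x + y) = f' x + f' y" for x y
      using linear_add[OF bounded_linear.linear[OF lin]] by (simp add: vec_eq_iff)
    show "f' (r *\<^sub>R x) = r *\<^sub>R f' x" for r x
      using linear_scale[OF bounded_linear.linear[OF lin]] by (simp add: vec_eq_iff)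
    have "norm (f' h) \<le> norm h * (\<Sum>i\<in>UNIV. K i)" for h
    proof -
      have "norm (f' h) \<le> (\<Sum>i\<in>UNIV. norm (f' h $ i))"
        unfolding norm_vec_def by (rule L2_set_le_sum) simp
      also have "\<dots> \<le> (\<Sum>i\<in>UNIV. norm h * K i)"
        by (rule sum_mono) (rule K)
      finally show ?thesis by (simp add: sum_distrib_left)
    qed
    then show "\<exists>K. \<forall>h. norm (f' h) \<le> norm h * K" by blast
  qed
  \<comment> \<open>\<open>Lim F (\<lambda>x. x)\<close> is how \<open>has_derivative\<close>
    expresses the base point of the filter \<open>F\<close>.\<close>
  moreover have "((\<lambda>y. ((f y - f (Lim F (\<lambda>x. x))) - f' (y - Lim F (\<lambda>x. x)))
      /\<^sub>R norm (y - Lim F (\<lambda>x. x))) \<longlongrightarrow> 0) F"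
    by (rule vec_tendstoI) (use assms in \<open>simp add: has_derivative_def\<close>)
  ultimately show ?thesis
    by (simp add: has_derivative_def)
qed

text \<open>A Frechet derivative is a priori only real linear; homogeneity over the ground field
  makes its matrix represent it.\<close>

lemma jacobian_mult_vector:
  fixes f :: "'a::real_normed_field ^ 'n \<Rightarrow> 'a ^ 'p"
  assumes "(f has_derivative L) (at x)" and "\<And>c h. L (c *s h) = c *s L h"
  shows "jacobian f (at x) *v h = L h"
proof -
  have "Vector_Spaces.linear (*s) (*s) L"
    using assms has_derivative_linear[OF assms(1)]
    by unfold_locales (auto simp: linear_add)
  then show ?thesis
    unfolding jacobian_def frechet_derivative_at[OF assms(1), symmetric] by (rule matrix_works)
qed

subsection \<open>Lifting over the cross cap\<close>

lemma vec_of_coords_nth: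
  fixes e :: "nat \<Rightarrow> 'n::finite"
  assumes "bij_betw e {1..CARD('n)} UNIV" and "m \<in> {1..CARD('n)}"
  shows "vec_of_coords e c $ e m = c m"
  using assms by (simp add: vec_of_coords_def bij_betw_def inv_into_f_f)

lemma sum_int_eq_sum_nat: "(\<Sum>r=1..int n. g r) = (\<Sum>r=1..n. g (int r))"
  by (rule sum.reindex_bij_witness[where i = int and j = nat]) auto

section \<open>Coordinate blocks of source and target\<close>

context
  fixes k :: nat and s :: "nat \<Rightarrow> 'n::finite" and t :: "nat \<Rightarrow> 'p::finite"
  assumes k: "2 \<le> k"
    and card_source: "CARD('n) = 2 * k - 2" and card_target: "CARD('p) = 2 * k - 1"
    and s: "bij_betw s {1..2 * k - 2} UNIV" and t: "bij_betw t {1..2 * k - 1} UNIV"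
begin

definition source_v :: "nat \<Rightarrow> 'n" where "source_v i = s (k - 2 + i)"
definition source_y :: 'n where "source_y = s (2 * k - 2)"
definition target_V :: "nat \<Rightarrow> 'p" where "target_V i = t (k - 2 + i)"
definition target_W1 :: 'p where "target_W1 = t (2 * k - 2)"
definition target_W2 :: 'p where "target_W2 = t (2 * k - 1)"

lemma nth_source:
  shows "i \<in> {1..k-2} \<Longrightarrow> vec_of_coords s c $ s i = c i"
    and "i \<in> {1..k-1} \<Longrightarrow> vec_of_coords s c $ source_v i = c (k-2+i)"
    and "vec_of_coords s c $ source_y = c (2*k-2)"
  unfolding source_v_def source_y_def
  by (rule vec_of_coords_nth; use k s card_source in auto)+

lemma nth_target:
  shows "i \<in> {1..k-2} \<Longrightarrow> vec_of_coords t c $ t i = c i"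
    and "i \<in> {1..k-1} \<Longrightarrow> vec_of_coords t c $ target_V i = c (k-2+i)"
    and "vec_of_coords t c $ target_W1 = c (2*k-2)"
    and "vec_of_coords t c $ target_W2 = c (2*k-1)"
  unfolding target_V_def target_W1_def target_W2_def
  by (rule vec_of_coords_nth; use k t card_target in auto)+

text \<open>Since \<open>t\<close> is onto, every target index lies in one of the blocks
  \<open>U\<close>, \<open>V\<close>, \<open>W1\<close>, \<open>W2\<close>. Componentwise claims
  below are split this way.\<close>

lemma all_target:
  "(\<forall>b. Q b) \<longleftrightarrow>
     (\<forall>i\<in>{1..k-2}. Q (t i)) \<and> (\<forall>i\<in>{1..k-1}. Q (target_V i)) \<and> Q target_W1 \<and> Q target_W2"
  (is "_ \<longleftrightarrow> ?R")
proof
  assume R: ?R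
  have "Q (t m)" if m: "1 \<le> m" "m \<le> 2 * k - 1" for m
  proof -
    have "m \<le> k - 2 \<or> (k - 2 < m \<and> m \<le> 2*k-3) \<or> m = 2*k-2 \<or> m = 2*k-1"
      using m by linarith
    then consider "m \<le> k - 2" | "k - 2 < m" "m \<le> 2*k-3" | "m = 2*k-2" | "m = 2*k-1"
      by blast
    then show ?thesis
    proof cases
      case 2
      then have "m - (k - 2) \<in> {1..k-1}" by auto
      with R have "Q (target_V (m - (k - 2)))" by blast
      with 2 show ?thesis
        by (simp add: target_V_def del: Nat.add_diff_assoc2 Nat.diff_diff_right Nat.add_diff_assoc)
    qed (use R m in \<open>auto simp: target_W1_def target_W2_def\<close>)
  qed
  moreover have "\<exists>m. 1 \<le> m \<and> m \<le> 2 * k - 1 \<and> b = t m" for b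
    using t unfolding bij_betw_def by (metis UNIV_I atLeastAtMost_iff image_iff)
  ultimately show "\<forall>b. Q b" by metis
qed auto

lemma index_U: "i \<le> k - 2 \<Longrightarrow> i \<le> 2 * k - 3"
  by auto

lemma index_V:
  assumes "i \<in> {1..k-1}"
  shows "\<not> k - 2 + i \<le> k - 2" and "k - 2 + i \<le> 2 * k - 3"
  using assms by auto

lemma index_W:
  "\<not> 2 * k - 2 \<le> k - 2" "\<not> 2 * k - 2 \<le> 2 * k - 3"
  "\<not> 2 * k - 1 \<le> k - 2" "\<not> 2 * k - 1 \<le> 2 * k - 3" "2 * k - 1 \<noteq> 2 * k - 2"
  using k by auto

lemma cross_cap_nth:
  fixes x :: "'a::real_normed_field ^ 'n"
  shows "i \<in> {1..k-2} \<Longrightarrow> cross_cap k s t x $ t i = x $ s i"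
    and "i \<in> {1..k-1} \<Longrightarrow> cross_cap k s t x $ target_V i = x $ source_v i"
    and "cross_cap k s t x $ target_W1 =
      (x $ source_y) ^ k + (\<Sum>i=1..k-2. x $ s i * (x $ source_y) ^ i)"
    and "cross_cap k s t x $ target_W2 = (\<Sum>i=1..k-1. x $ source_v i * (x $ source_y) ^ i)"
  unfolding cross_cap_def Let_def source_v_def source_y_def
  by (simp_all add: nth_target index_V index_W del: One_nat_def)

lemma xi2_nth:
  fixes X :: "'a::real_normed_field ^ 'p"
  defines "U \<equiv> U_coord k t X" and "V \<equiv> V_coord k t X" and "W \<equiv> X $ target_W1"
  shows "i \<in> {1..k-2} \<Longrightarrow> xi2 k t j X $ t i = A2 k U W i j"
    and "i \<in> {1..k-1} \<Longrightarrow> xi2 k t j X $ target_V i = B2 k U V W i j"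
    and "xi2 k t j X $ target_W1 = C2_1 k U W j"
    and "xi2 k t j X $ target_W2 = C2_2 k U V W j"
  unfolding xi2_def Let_def U_def V_def W_def target_W1_def[symmetric]
  by (simp_all add: nth_target index_V index_W del: One_nat_def)

lemma polynomial_map_U_coord: "polynomial_map (\<lambda>X. U_coord k t X r)"
  unfolding U_coord_def by (intro polynomial_map_If polynomial_map_intros)

lemma polynomial_map_V_coord: "polynomial_map (\<lambda>X. V_coord k t X r)"
  unfolding V_coord_def by (intro polynomial_map_If polynomial_map_intros)

lemma polynomial_map_xi2: "polynomial_map (\<lambda>X. xi2 k t j X $ b)"
proof -
  have "\<forall>b. polynomial_map (\<lambda>X. xi2 k t j X $ b)"
    unfolding all_target
    by (auto simp: xi2_nth A2_def B2_def C2_1_def C2_2_def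
        intro!: polynomial_map_intros polynomial_map_U_coord polynomial_map_V_coord)
  then show ?thesis ..
qed

lemma polynomial_map_cross_cap: "polynomial_map (\<lambda>x. cross_cap k s t x $ b)"
proof -
  have "\<forall>b. polynomial_map (\<lambda>x. cross_cap k s t x $ b)"
    unfolding all_target by (auto simp: cross_cap_nth intro!: polynomial_map_intros)
  then show ?thesis ..
qed

lemma cross_cap_0: "cross_cap k s t 0 = 0"
proof -
  have "\<forall>b. cross_cap k s t (0 :: 'a ^ 'n) $ b = 0"
    unfolding all_target using k by (auto simp: cross_cap_nth)
  then show ?thesis by (simp add: vec_eq_iff)
qed

section \<open>Derivative of the cross cap map\<close>

definition cross_cap_derivative ::
  "'a::real_normed_field ^ 'n \<Rightarrow> 'a ^ 'n \<Rightarrow> 'a ^ 'p" where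
  "cross_cap_derivative x h =
     (let y = x $ source_y; z = h $ source_y in
      vec_of_coords t (\<lambda>m.
        if m \<le> 2 * k - 3 then h $ s m
        else if m = 2 * k - 2 then
          (\<Sum>i=1..k-2. h $ s i * y ^ i) +
          (of_nat k * y ^ (k-1) + (\<Sum>i=1..k-2. of_nat i * x $ s i * y ^ (i-1))) * z
        else
          (\<Sum>i=1..k-1. h $ source_v i * y ^ i) +
          (\<Sum>i=1..k-1. of_nat i * x $ source_v i * y ^ (i-1)) * z))"

lemma cross_cap_derivative_nth:
  fixes x h :: "'a::real_normed_field ^ 'n"
  defines "y \<equiv> x $ source_y" and "z \<equiv> h $ source_y"
  shows "m \<in> {1..k-2} \<Longrightarrow> cross_cap_derivative x h $ t m = h $ s m"
    and "m \<in> {1..k-1} \<Longrightarrow> cross_cap_derivative x h $ target_V m = h $ source_v m"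
    and "cross_cap_derivative x h $ target_W1 =
          (\<Sum>i=1..k-2. h $ s i * y ^ i) +
          (of_nat k * y ^ (k-1) + (\<Sum>i=1..k-2. of_nat i * x $ s i * y ^ (i-1))) * z"
    and "cross_cap_derivative x h $ target_W2 =
          (\<Sum>i=1..k-1. h $ source_v i * y ^ i) +
          (\<Sum>i=1..k-1. of_nat i * x $ source_v i * y ^ (i-1)) * z"
  unfolding cross_cap_derivative_def Let_def y_def z_def source_v_def
  by (simp_all add: nth_target index_U index_V index_W del: One_nat_def)

lemma has_derivative_cross_cap:
  "(cross_cap k s t has_derivative cross_cap_derivative x) (at x)"
proof (rule has_derivative_vec)
  note [derivative_intros] = bounded_linear.has_derivative[OF bounded_linear_vec_nth]
  have "\<forall>b. ((\<lambda>x. cross_cap k s t x $ b) has_derivative (\<lambda>h. cross_cap_derivative x h $ b)) (at x)"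
    unfolding all_target using k
    by (auto simp: cross_cap_nth cross_cap_derivative_nth algebra_simps sum_distrib_left
        sum.distrib intro!: derivative_eq_intros)
  then show "((\<lambda>x. cross_cap k s t x $ b) has_derivative (\<lambda>h. cross_cap_derivative x h $ b)) (at x)"
    for b ..
qed

lemma cross_cap_derivative_scale: "cross_cap_derivative x (c *s h) = c *s cross_cap_derivative x h"
proof -
  have "\<forall>b. cross_cap_derivative x (c *s h) $ b = (c *s cross_cap_derivative x h) $ b"
    unfolding all_target
    by (auto simp: cross_cap_derivative_nth algebra_simps sum_distrib_left)
  then show ?thesis by (simp add: vec_eq_iff)
qed

section \<open>The lift\<close>

text \<open>This is \<open>E\<close> with \<open>d = k-j+1\<close>, its coefficients taken at the
  image point.\<close>

definition lift_last :: "nat \<Rightarrow> 'a::real_normed_field ^ 'n \<Rightarrow> 'a" where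
  "lift_last j x =
     (let U = U_coord k t (cross_cap k s t x) in
      of_int (int k) *
        (\<Sum>r=int k-int j+1..int k. U r * (x $ source_y) ^ nat (r - (int k-int j+1) + 1)) +
      of_int (int j) * U (int k - int j))"

definition lift :: "nat \<Rightarrow> 'a::real_normed_field ^ 'n \<Rightarrow> 'a ^ 'n" where
  "lift j x = vec_of_coords s
     (\<lambda>m. if m \<le> 2 * k - 3 then xi2 k t j (cross_cap k s t x) $ t m else lift_last j x)"

lemma polynomial_map_lift: "polynomial_map (\<lambda>x. lift j x $ b)"
proof -
  note U = polynomial_map_compose[OF polynomial_map_U_coord polynomial_map_cross_cap]
  note xi = polynomial_map_compose[OF polynomial_map_xi2 polynomial_map_cross_cap]
  show ?thesis
    unfolding lift_def vec_of_coords_def lift_last_def Let_def vec_lambda_beta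
    by (intro polynomial_map_If polynomial_map_intros U xi)
qed

text \<open>The \<open>U\<close> and \<open>V\<close> rows hold by construction of
  \<open>lift\<close>. The \<open>W1\<close> and \<open>W2\<close> rows are the generating function
  identity with second coefficient family \<open>U\<close> and \<open>V\<close>
  respectively.\<close>

lemma cross_cap_derivative_lift:
  fixes x :: "'a::real_normed_field ^ 'n"
  assumes j: "1 \<le> j" "j \<le> k - 1"
  shows "cross_cap_derivative x (lift j x) = xi2 k t j (cross_cap k s t x)"
proof -
  define X where "X = cross_cap k s t x"
  define U where "U = U_coord k t X"
  define V where "V = V_coord k t X"
  define W where "W = X $ target_W1"
  define y where "y = x $ source_y"
  have U_nth: "U (int r) = x $ s r" if "r \<in> {1..k-2}" for r
  proof -
    have "int r \<le> int k - 2" using that by auto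
    with that show ?thesis by (simp add: U_def U_coord_def X_def cross_cap_nth)
  qed
  have V_nth: "V (int r) = x $ source_v r" if "r \<in> {1..k-1}" for r
  proof -
    have "int r \<le> int k - 1" using that by auto
    with that have "V (int r) = X $ target_V r"
      unfolding V_def V_coord_def target_V_def by simp
    with that show ?thesis
      by (simp only: X_def cross_cap_nth)
  qed
  have U_0: "U r = 0" if "r < 1 \<or> int k < r" for r
    using that k by (auto simp: U_def U_coord_def)
  have V_0: "V r = 0" if "r < 1 \<or> int k < r" for r
    using that k by (auto simp: V_def V_coord_def)
  have U_top: "U (int k) = 1" "U (int k - 1) = 0"
    using k by (auto simp: U_def U_coord_def)
  have V_top: "V (int k) = 0"
    using k by (auto simp: V_def V_coord_def)
  obtain n where n: "k = Suc (Suc n)"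
    using k by (metis add_2_eq_Suc le_Suc_ex)
  have split: "(\<Sum>r=1..k. g r) = (\<Sum>r=1..k-2. g r) + g (k-1) + g k"
    "(\<Sum>r=1..k. g r) = (\<Sum>r=1..k-1. g r) + g k"
    "(\<Sum>r=1..k-1. g r) = (\<Sum>r=1..k-2. g r) + g (k-1)" for g :: "nat \<Rightarrow> 'a"
    by (simp_all add: n)
  have U_sum: "(\<Sum>r=1..k-2. f r (U (int r))) = (\<Sum>r=1..k-2. f r (x $ s r))"
    for f :: "nat \<Rightarrow> 'a \<Rightarrow> 'a"
    by (rule sum.cong) (simp_all add: U_nth)
  have V_sum: "(\<Sum>r=1..k-1. f r (V (int r))) = (\<Sum>r=1..k-1. f r (x $ source_v r))"
    for f :: "nat \<Rightarrow> 'a \<Rightarrow> 'a"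
    by (rule sum.cong) (simp_all add: V_nth)
  have km1: "int (k - 1) = int k - 1" using k by simp
  \<comment> \<open>On the image of the map, \<open>W\<close> is the value of \<open>P\<close> at
    \<open>y\<close>: the dummies \<open>U k = 1\<close> and \<open>U (k-1) = 0\<close> supply the
    leading power and remove the next one.\<close>
  have W: "W = (\<Sum>r=1..int k. U r * y ^ nat r)"
    unfolding sum_int_eq_sum_nat split(1) nat_int U_sum[of "\<lambda>r u. u * y ^ r"]
    by (simp add: W_def X_def cross_cap_nth y_def U_top km1 del: One_nat_def)
  have z: "lift j x $ source_y = lift_last j x"
    by (simp add: lift_def nth_source index_W)
  have h_u: "lift j x $ s i = xi2 k t j X $ t i" if "i \<in> {1..k-2}" for i
    using index_U[of i] that by (simp add: lift_def nth_source(1)[OF that] X_def)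
  have h_v: "lift j x $ source_v i = xi2 k t j X $ target_V i" if "i \<in> {1..k-1}" for i
    using index_V(2)[OF that]
    by (simp only: lift_def nth_source(2)[OF that] X_def target_V_def if_True)
  \<comment> \<open>\<open>V'\<close> is left open, to be taken as \<open>U\<close> and as
    \<open>V\<close>.\<close>
  have gen: "(\<Sum>i=1..int k-1. B2 (int k) U V' W i (int j) * y ^ nat i) +
        (\<Sum>r=1..int k. of_int r * V' r * y ^ nat (r-1)) * lift_last j x = C2_2 (int k) U V' W (int j)"
    if "\<And>r. r < 1 \<or> int k < r \<Longrightarrow> V' r = 0" for V'
    unfolding W lift_last_def Let_def X_def[symmetric] U_def[symmetric] y_def[symmetric]
    by (rule B2_generating_function[OF refl]) (use j k U_0 that in auto)
  have gen_nat: "(\<Sum>i=1..k-1. B2 (int k) U V' W (int i) (int j) * y ^ i) +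
        (\<Sum>r=1..k. of_nat r * V' (int r) * y ^ (r-1)) * lift_last j x = C2_2 (int k) U V' W (int j)"
    if "\<And>r. r < 1 \<or> int k < r \<Longrightarrow> V' r = 0" for V'
  proof -
    have "(\<Sum>r=1..k. of_nat r * V' (int r) * y ^ (r-1)) =
        (\<Sum>r=1..k. of_int (int r) * V' (int r) * y ^ nat (int r-1))"
      by (rule sum.cong) (auto simp: nat_diff_distrib)
    then show ?thesis
      using gen[OF that] unfolding km1[symmetric] sum_int_eq_sum_nat by simp
  qed
  have "\<forall>b. cross_cap_derivative x (lift j x) $ b = xi2 k t j X $ b"
    unfolding all_target
  proof (intro conjI ballI)
    fix i assume "i \<in> {1..k-2}"
    then show "cross_cap_derivative x (lift j x) $ t i = xi2 k t j X $ t i"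
      by (simp only: cross_cap_derivative_nth h_u h_v)
  next
    fix i assume "i \<in> {1..k-1}"
    then show "cross_cap_derivative x (lift j x) $ target_V i = xi2 k t j X $ target_V i"
      by (simp only: cross_cap_derivative_nth h_u h_v)
  next
    have "(\<Sum>i=1..k-2. lift j x $ s i * y ^ i) =
        (\<Sum>i=1..k-1. B2 (int k) U U W (int i) (int j) * y ^ i)"
    proof -
      \<comment> \<open>There are only \<open>k-2\<close> components \<open>A2\<close>, while the
        identity sums up to \<open>k-1\<close>; the additional coefficient is zero.\<close>
      have "B2 (int k) U U W (int (k-1)) (int j) = 0"
        unfolding km1 by (rule B2_diagonal_eq_0[OF refl]) (use j k U_0 U_top in auto)
      moreover have "(\<Sum>i=1..k-2. lift j x $ s i * y ^ i) =
          (\<Sum>i=1..k-2. B2 (int k) U U W (int i) (int j) * y ^ i)"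
        by (rule sum.cong)
           (auto simp: h_u h_v xi2_nth A2_eq_B2 U_def[symmetric] W_def[symmetric])
      ultimately show ?thesis unfolding split(3) by simp
    qed
    \<comment> \<open>Both sides are the derivative of \<open>P\<close> in \<open>y\<close>, without
      and with the dummy coordinates.\<close>
    moreover have "of_nat k * y ^ (k-1) + (\<Sum>i=1..k-2. of_nat i * x $ s i * y ^ (i-1)) =
        (\<Sum>r=1..k. of_nat r * U (int r) * y ^ (r-1))"
      unfolding split(1) U_sum[of "\<lambda>r u. of_nat r * u * y ^ (r-1)"]
      by (simp add: U_top km1 del: One_nat_def)
    ultimately show "cross_cap_derivative x (lift j x) $ target_W1 = xi2 k t j X $ target_W1"
      using gen_nat[OF U_0]
      by (simp add: cross_cap_derivative_nth xi2_nth z C2_1_eq_C2_2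
          U_def[symmetric] W_def[symmetric] y_def[symmetric])
  next
    have "(\<Sum>i=1..k-1. lift j x $ source_v i * y ^ i) =
        (\<Sum>i=1..k-1. B2 (int k) U V W (int i) (int j) * y ^ i)"
      by (rule sum.cong)
         (use k in \<open>auto simp: h_u h_v xi2_nth U_def[symmetric] V_def[symmetric] W_def[symmetric]\<close>)
    moreover have "(\<Sum>i=1..k-1. of_nat i * x $ source_v i * y ^ (i-1)) =
        (\<Sum>r=1..k. of_nat r * V (int r) * y ^ (r-1))"
      unfolding split(2) V_sum[of "\<lambda>r u. of_nat r * u * y ^ (r-1)"]
      by (simp add: V_top)
    ultimately show "cross_cap_derivative x (lift j x) $ target_W2 = xi2 k t j X $ target_W2"
      using gen_nat[OF V_0]
      by (simp add: cross_cap_derivative_nth xi2_nth z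
          U_def[symmetric] V_def[symmetric] W_def[symmetric] y_def[symmetric])
  qed
  then show ?thesis by (simp add: vec_eq_iff X_def)
qed

lemma liftable_xi2:
  assumes "1 \<le> j" and "j \<le> k - 1"
  shows "liftable \<rho> (cross_cap k s t :: 'a::real_normed_field ^ 'n \<Rightarrow> 'a ^ 'p) (xi2 k t j)"
proof -
  let ?f = "cross_cap k s t :: 'a ^ 'n \<Rightarrow> 'a ^ 'p"
  have "map_germ \<rho> ?f" and "vector_field_germ \<rho> (xi2 k t j :: 'a ^ 'p \<Rightarrow> 'a ^ 'p)"
    and "vector_field_germ \<rho> (lift j :: 'a ^ 'n \<Rightarrow> 'a ^ 'n)"
    unfolding map_germ_def vector_field_germ_def
    by (simp_all add: cross_cap_0 polynomial_map_function_germ polynomial_map_cross_cap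
        polynomial_map_xi2 polynomial_map_lift)
  moreover have "jacobian ?f (at x) *v lift j x = xi2 k t j (?f x)" for x
    unfolding jacobian_mult_vector[OF has_derivative_cross_cap cross_cap_derivative_scale]
    by (rule cross_cap_derivative_lift[OF assms])
  ultimately show ?thesis
    unfolding liftable_def by (meson always_eventually)
qed

end

theorem theorem3p2:
  fixes k j :: nat
    and s :: "nat \<Rightarrow> 'n::finite" and t :: "nat \<Rightarrow> 'p::finite"
    and \<rho> :: regularity
  assumes "2 \<le> k" and "1 \<le> j" and "j \<le> k - 1"
    and "CARD('n) = 2 * k - 2" and "CARD('p) = 2 * k - 1"
    and "bij_betw s {1..2 * k - 2} UNIV" and "bij_betw t {1..2 * k - 1} UNIV"
  shows "liftable \<rho> (cross_cap k s t :: real ^ 'n \<Rightarrow> real ^ 'p) (xi2 k t j) \<and>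
         liftable \<rho> (cross_cap k s t :: complex ^ 'n \<Rightarrow> complex ^ 'p) (xi2 k t j)"
  by (intro conjI liftable_xi2 assms)

end
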